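(* Let $(A,B,p,r,c)$ be an LPP situation with producer set $N$. If $M^{\min}=\varnothing$, then the corresponding partition function form game $(N,\mathcal{P}(N),\{V(\bullet|P)\}_{P\in\mathcal{P}(N)})$ is a characteristic function form game, i.e. for every nonempty $S\subseteq N$ and all $P,P'\in\mathcal{P}(N)$ with $S\in P$ and $S\in P'$ one has $V(S|P)=V(S|P')$.
   Context: LPP situation (linear production situation with a common-pool resource). $N=\{1,\dots,n\}$ is a set of producers, $G=\{1,\dots,g\}$ a set of goods, $Q=\{1,\dots,q\}$ a set of resources; in addition there is one external common-pool resource, of which a total amount $r\ge 0$ is available at unit cost $c\ge 0$. Producer $i$ owns $b^i\in\mathbb{R}_+^q$; $b^S=\sum_{i\in S}b^i$; $B$ is the $q\times n$ matrix with columns $b^i$, and for every $t\in Q$ there is a producer $i$ with $b^i_t>0$. $A$ is a nonnegative $(q+1)\times g$ matrix ($a_{tj}$ is the amount of resource $t$ needed per unit of good $j$; row $q+1$ refers to the common-pool resource), with $a_{(q+1)j}>0$ for all $j\in G$ and, for every $j\in G$, some $t\in Q$ with $a_{tj}>0$. $p\in\mathbb{R}_{++}^g$ is the price vector and $p_j>a_{(q+1)j}c$ for all $j\in G$. For a coalition $S\subseteq N$ and $z\ge 0$, $$\mathrm{value}(S;z)=\max\Big\{\sum_{j=1}^g p_jx_j-cz \;:\; Ax\le \begin{pmatrix} b^S\\ z\end{pmatrix},\ x\in\mathbb{R}^g_+\Big\}.$$ The optimal demand of $S$ is $d_S=\min\{z\ge 0:\ \mathrm{value}(S;z)=\max_{z'\ge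 0}\mathrm{value}(S;z')\}$. It is assumed that for every nonempty $S$ there is $z$ with $\mathrm{value}(S;z)>0$ (so $d_S>0$). $\mathcal{P}(N)$ is the set of partitions of $N$ into nonempty coalitions. $P'$ is a refinement of $P$, written $P'\subseteq P$, if each $S'\in P'$ is contained in some $S\in P$. For $P\in\mathcal{P}(N)$ put $d(P)=\sum_{S\in P}d_S$. Then $M^{\min}=\{P\in\mathcal{P}(N): d(P)>r$ and $P$ is minimal for $\subseteq\}$, where minimal means that no refinement $P'\neq P$ of $P$ satisfies $d(P')>r$. Partition function form game. When partition $P$ forms, the manager of the common-pool resource allocates (by some fixed procedure) an amount $z_S(P)\ge 0$ to each $S\in P$, with $z_S(P)\le d_S$, $\sum_{S\in P}z_S(P)\le r$, and with $z_S(P)=d_S$ for all $S\in P$ whenever $d(P)\le r$; also $z_N(\{N\})=\min\{d_N,r\}$. Then $V(S|P)=\mathrm{value}(S;z_S(P))$ for $S\in P$. *)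

theory Defs
  imports "HOL-Analysis.Analysis"
begin

text \<open>
  Producers, goods and resources are the finite types \<open>'n\<close>, \<open>'g\<close> and \<open>'q\<close>; the grand coalition is
  \<open>UNIV :: 'n set\<close>. The rows of the technology matrix are indexed by \<open>'q option\<close>: row \<open>Some t\<close>
  belongs to resource \<open>t\<close>, row \<open>None\<close> (row q+1 in the usual numbering) to the common-pool resource.
\<close>

definition coalition_resources :: "real^'n^'q \<Rightarrow> 'n set \<Rightarrow> real^'q" where
  "coalition_resources B S = (\<Sum>i\<in>S. column i B)"

definition resource_bounds :: "real^'q \<Rightarrow> real \<Rightarrow> real^('q option)" where
  "resource_bounds b z = (\<chi> t. case t of Some s \<Rightarrow> b $ s | None \<Rightarrow> z)"

definition feasible_plans ::
  "real^'g^('q::finite option) \<Rightarrow> real^'n^'q \<Rightarrow> 'n set \<Rightarrow> real \<Rightarrow> (real^'g) set" where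
  "feasible_plans A B S z = {x. 0 \<le> x \<and> A *v x \<le> resource_bounds (coalition_resources B S) z}"

text \<open>
  Under the assumptions of \<open>lpp_situation\<close> below, the maxima and the minimum that \<open>GREATEST\<close> and
  \<open>LEAST\<close> denote in the next three definitions exist for nonnegative \<open>z\<close>: every good needs some
  resource of type \<open>'q\<close>, so the set of plans is compact, uniformly in \<open>z\<close>.
\<close>

definition coalition_value ::
  "real^'g^('q::finite option) \<Rightarrow> real^'n^'q \<Rightarrow> real^'g \<Rightarrow> real \<Rightarrow> 'n set \<Rightarrow> real \<Rightarrow> real" where
  "coalition_value A B p c S z =
     (GREATEST v. \<exists>x \<in> feasible_plans A B S z. v = (\<Sum>j\<in>UNIV. p $ j * x $ j) - c * z)"

definition max_coalition_value ::
  "real^'g^('q::finite option) \<Rightarrow> real^'n^'q \<Rightarrow> real^'g \<Rightarrow> real \<Rightarrow> 'n set \<Rightarrow> real" where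
  "max_coalition_value A B p c S = (GREATEST v. \<exists>z\<ge>0. v = coalition_value A B p c S z)"

definition optimal_demand ::
  "real^'g^('q::finite option) \<Rightarrow> real^'n^'q \<Rightarrow> real^'g \<Rightarrow> real \<Rightarrow> 'n set \<Rightarrow> real" where
  "optimal_demand A B p c S =
     (LEAST z. 0 \<le> z \<and> coalition_value A B p c S z = max_coalition_value A B p c S)"

locale lpp_situation =
  fixes A :: "real^'g^('q::finite option)" and B :: "real^'n^'q" and p :: "real^'g"
    and r c :: real
  assumes pool_nonneg: "0 \<le> r"
    and cost_nonneg: "0 \<le> c"
    and endowment_nonneg: "0 \<le> B $ t $ i"
    and resource_owned: "\<exists>i. 0 < B $ t $ i"
    and technology_nonneg: "0 \<le> A $ k $ j"
    and common_pool_needed: "0 < A $ None $ j"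
    and resource_needed: "\<exists>t. 0 < A $ Some t $ j"
    and price_pos: "0 < p $ j"
    and price_gt_cost: "A $ None $ j * c < p $ j"
    and profitable: "S \<noteq> {} \<Longrightarrow> \<exists>z\<ge>0. 0 < coalition_value A B p c S z"

definition total_demand ::
  "real^'g^('q::finite option) \<Rightarrow> real^'n^'q \<Rightarrow> real^'g \<Rightarrow> real \<Rightarrow> 'n set set \<Rightarrow> real" where
  "total_demand A B p c P = (\<Sum>S\<in>P. optimal_demand A B p c S)"

definition M_min ::
  "real^'g^('q::finite option) \<Rightarrow> real^'n^'q \<Rightarrow> real^'g \<Rightarrow> real \<Rightarrow> real \<Rightarrow> 'n set set set" where
  "M_min A B p r c =
     {P. partition_on UNIV P \<and> r < total_demand A B p c P \<and>
         \<not> (\<exists>P'. refines UNIV P' P \<and> P' \<noteq> P \<and> r < total_demand A B p c P')}"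

text \<open>
  \<open>z P S\<close> is the amount of the common-pool resource that the manager allocates to coalition \<open>S\<close> when
  partition \<open>P\<close> forms; only its values for partitions \<open>P\<close> and \<open>S \<in> P\<close> are meaningful.
\<close>

locale allocation_procedure =
  fixes A :: "real^'g^('q::finite option)" and B :: "real^'n^'q" and p :: "real^'g"
    and r c :: real and z :: "'n set set \<Rightarrow> 'n set \<Rightarrow> real"
  assumes allocation_nonneg: "partition_on UNIV P \<Longrightarrow> S \<in> P \<Longrightarrow> 0 \<le> z P S"
    and allocation_le_demand: "partition_on UNIV P \<Longrightarrow> S \<in> P \<Longrightarrow> z P S \<le> optimal_demand A B p c S"
    and allocation_feasible: "partition_on UNIV P \<Longrightarrow> (\<Sum>S\<in>P. z P S) \<le> r"
    and allocation_eq_demand: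
      "partition_on UNIV P \<Longrightarrow> total_demand A B p c P \<le> r \<Longrightarrow> S \<in> P \<Longrightarrow>
         z P S = optimal_demand A B p c S"
    and allocation_grand: "z {UNIV} UNIV = min (optimal_demand A B p c UNIV) r"

definition partition_function ::
  "real^'g^('q::finite option) \<Rightarrow> real^'n^'q \<Rightarrow> real^'g \<Rightarrow> real \<Rightarrow> ('n set set \<Rightarrow> 'n set \<Rightarrow> real)
     \<Rightarrow> 'n set \<Rightarrow> 'n set set \<Rightarrow> real" where
  "partition_function A B p c z S P = coalition_value A B p c S (z P S)"

definition characteristic_function_form :: "'n set \<Rightarrow> ('n set \<Rightarrow> 'n set set \<Rightarrow> real) \<Rightarrow> bool" where
  "characteristic_function_form N V \<longleftrightarrow>
     (\<forall>S P P'. S \<noteq> {} \<and> S \<subseteq> N \<and> partition_on N P \<and> partition_on N P' \<and> S \<in> P \<and> S \<in> P'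
        \<longrightarrow> V S P = V S P')"

end

theory Submission
  imports Defs
begin

text \<open>
  There are finitely many partitions, so if some partition has total demand above \<open>r\<close>, then a minimal
  one does. Hence if \<open>M_min\<close> is empty, every partition meets all demands in full, and the allocation
  to a coalition is its optimal demand, whatever the partition is.
\<close>

lemma M_min_nonempty:
  fixes A :: "real^'g^('q::finite option)" and B :: "real^'n^'q"
  assumes "partition_on UNIV P" "r < total_demand A B p c P"
  shows "M_min A B p r c \<noteq> {}"
proof -
  define X where "X = {P. partition_on (UNIV :: 'n set) P \<and> r < total_demand A B p c P}"
  have "asymp_on X (\<lambda>P' P. refines UNIV P' P \<and> P' \<noteq> P)"
    by (auto intro!: asymp_onI dest: refines_asym)
  \<comment> \<open>Distinctness survives composition: if the ends of a chain coincided,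
    antisymmetry of refinement would force the middle to equal them.\<close>
  moreover have "transp_on X (\<lambda>P' P. refines UNIV P' P \<and> P' \<noteq> P)"
    by (intro transp_onI) (metis refines_asym refines_trans)
  moreover have "finite X" "X \<noteq> {}"
    using assms by (auto simp: X_def)
  ultimately obtain Q where "Q \<in> X" "\<forall>P'\<in>X. P' \<noteq> Q \<longrightarrow> \<not> (refines UNIV P' Q \<and> P' \<noteq> Q)"
    using Finite_Set.bex_min_element by blast
  \<comment> \<open>Minimality within \<open>X\<close> suffices: \<open>refines\<close> makes
    \<open>P'\<close> a partition, so a refinement with demand above \<open>r\<close> lies in
    \<open>X\<close>.\<close>
  then have "Q \<in> M_min A B p r c"
    by (auto simp: X_def M_min_def refines_def)
  then show ?thesis by blast
qed

theorem proposition6: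
  fixes A :: "real^'g^('q::finite option)" and B :: "real^'n^'q" and p :: "real^'g"
    and r c :: real and z :: "'n set set \<Rightarrow> 'n set \<Rightarrow> real"
  assumes "lpp_situation A B p r c"
    and "allocation_procedure A B p r c z"
    and "M_min A B p r c = {}"
  shows "characteristic_function_form (UNIV :: 'n set) (partition_function A B p c z)"
proof -
  \<comment> \<open>Otherwise the total demand of \<open>P\<close> would exceed \<open>r\<close>,
    and \<open>M_min\<close> would be nonempty.\<close>
  have "z P S = optimal_demand A B p c S" if "partition_on UNIV P" "S \<in> P" for P S
    using allocation_procedure.allocation_eq_demand[OF assms(2)] M_min_nonempty assms(3) that
    by (meson not_le)
  then show ?thesis
    by (simp add: characteristic_function_form_def partition_function_def)
qed

end
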